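(* Let $R$ be a finite local ring with $|R|=q^n$ and $R/J=GF(q)$, where $n$ is a positive integer, and suppose that $J^2 = 0$. Then for every $x \in R$, $$\mathrm{Prob}_x(R)=\begin{cases} \frac{2(q-1)}{q^{n+1}}, & \text{if } 0 \neq x \in J, \\ \frac{q-1}{q^{n+1}}, & \text{if } x \notin J, \\ \frac{q^{n-1}+2q-2}{q^{n+1}}, & \text{if } x=0. \end{cases}$$
   Context: Rings are associative with unity $1$, not necessarily commutative. $J=J(R)$ is the Jacobson radical of $R$, and $GF(q)$ is the finite field with $q$ elements ($R/J=GF(q)$ means isomorphic as rings). For a finite ring $R$ and $x \in R$, the multiplication probability is $\mathrm{Prob}_x(R)=\frac{|\{(a,b) \in R^2 : ab=x\}|}{|R|^2}$. *)

theory Defs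
  imports "HOL-Algebra.Algebra"
begin

text \<open>
  Rings are the unital, not necessarily commutative rings of the locale \<^locale>\<open>ring\<close>. The library's
  \<^locale>\<open>ideal\<close> and \<^locale>\<open>maximalideal\<close> are two-sided, whereas locality and the Jacobson radical of a
  noncommutative ring refer to maximal left ideals.
\<close>

locale left_ideal = additive_subgroup I R + ring R for I and R (structure) +
  assumes I_l_closed: "\<lbrakk>a \<in> I; x \<in> carrier R\<rbrakk> \<Longrightarrow> x \<otimes> a \<in> I"

locale maximal_left_ideal = left_ideal +
  assumes I_notcarr: "I \<noteq> carrier R"
    and I_maximal: "\<lbrakk>left_ideal K R; I \<subseteq> K\<rbrakk> \<Longrightarrow> K = I \<or> K = carrier R"

locale local_ring = ring +
  assumes unique_maximal_left_ideal: "\<exists>!M. maximal_left_ideal M R"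

text \<open>Intersecting with the carrier makes the radical of the zero ring the whole ring.\<close>

definition jacobson_radical :: "('a, 'm) ring_scheme \<Rightarrow> 'a set" where
  "jacobson_radical R = carrier R \<inter> \<Inter> {M. maximal_left_ideal M R}"

definition mult_prob :: "('a, 'm) ring_scheme \<Rightarrow> 'a \<Rightarrow> real" where
  "mult_prob R x =
     real (card {(a, b). a \<in> carrier R \<and> b \<in> carrier R \<and> a \<otimes>\<^bsub>R\<^esub> b = x}) /
     real (card (carrier R)) ^ 2"

end

theory Submission
  imports Defs
begin

text \<open>
  In a finite local ring the elements outside the radical \<open>J\<close> are exactly the units
  (\<open>finite_local_ring_Units\<close>). In a finite monoid, both factors of a unit are units
  (\<open>finite_mult_in_Units\<close>), so a product with at least one factor in \<open>J\<close>, on either side, lies in \<open>J\<close>.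

  If \<open>x\<close> is a unit, then both factors in \<open>x = a b\<close> are units, and there is one such pair for each unit
  \<open>a\<close>. If \<open>x \<in> J\<close>, then either \<open>a\<close> is a unit and \<open>b = a\<inverse> x \<in> J\<close>, or \<open>b\<close> is a unit and
  \<open>a = x b\<inverse> \<in> J\<close>, or both factors lie in \<open>J\<close>. These cases exclude each other; the last one requires
  \<open>x = 0\<close>, because \<open>J\<^sup>2 = 0\<close>, and then every pair in \<open>J \<times> J\<close> qualifies. So the number of pairs is \<open>u\<close>
  for units, \<open>2 u\<close> for nonzero elements of \<open>J\<close> and \<open>2 u + \<bar>J\<bar>\<^sup>2\<close> for zero, where \<open>u = \<bar>R\<bar> - \<bar>J\<bar>\<close>
  (\<open>card_factor_pairs_unit\<close>, \<open>card_factor_pairs_radical\<close>). Lagrange's theorem for the additive group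
  gives \<open>\<bar>J\<bar> = q ^ (n - 1)\<close>.
\<close>

section \<open>Units of finite monoids\<close>

lemma (in monoid) finite_right_inverse_Units:
  assumes "finite (carrier G)" "a \<in> carrier G" "b \<in> carrier G" "a \<otimes> b = \<one>"
  shows "a \<in> Units G" "b \<in> Units G"
proof -
  \<comment> \<open>Left multiplication by \<open>b\<close> is injective, hence surjective, so \<open>b\<close> also has a right inverse.\<close>
  have "inj_on (\<lambda>z. b \<otimes> z) (carrier G)"
  proof (rule inj_on_inverseI)
    show "a \<otimes> (b \<otimes> z) = z" if "z \<in> carrier G" for z
      using assms that by (simp flip: m_assoc)
  qed
  moreover have "(\<lambda>z. b \<otimes> z) ` carrier G \<subseteq> carrier G"
    using assms by auto
  ultimately have "(\<lambda>z. b \<otimes> z) ` carrier G = carrier G"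
    using assms(1) by (intro endo_inj_surj)
  then obtain c where c: "c \<in> carrier G" "b \<otimes> c = \<one>"
    by (metis imageE one_closed)
  have "a = c"
    using assms c by (metis l_one m_assoc r_one)
  then show "a \<in> Units G" "b \<in> Units G"
    using assms c unfolding Units_def by blast+
qed

lemma (in monoid) finite_mult_in_Units:
  assumes "finite (carrier G)" "a \<in> carrier G" "b \<in> carrier G" "a \<otimes> b \<in> Units G"
  shows "a \<in> Units G" "b \<in> Units G"
proof -
  let ?i = "inv (a \<otimes> b)"
  have "a \<otimes> (b \<otimes> ?i) = \<one>" "(?i \<otimes> a) \<otimes> b = \<one>"
    using assms by (simp_all add: m_assoc flip: m_assoc[of a b])
  then show "a \<in> Units G" "b \<in> Units G"
    using assms finite_right_inverse_Units by (metis Units_inv_closed m_closed)+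
qed

section \<open>Units and radical of a finite local ring\<close>

lemma (in ring) left_ideal_principal:
  assumes "a \<in> carrier R"
  shows "left_ideal ((\<lambda>r. r \<otimes> a) ` carrier R) R"
proof -
  have "additive_subgroup ((\<lambda>r. r \<otimes> a) ` carrier R) R"
  proof (intro additive_subgroup.intro subgroup.intro)
    show "(\<lambda>r. r \<otimes> a) ` carrier R \<subseteq> carrier (add_monoid R)"
      using assms by auto
    show "y \<otimes>\<^bsub>add_monoid R\<^esub> z \<in> (\<lambda>r. r \<otimes> a) ` carrier R"
      if "y \<in> (\<lambda>r. r \<otimes> a) ` carrier R" "z \<in> (\<lambda>r. r \<otimes> a) ` carrier R" for y z
    proof -
      from that obtain s t where "s \<in> carrier R" "t \<in> carrier R" "y = s \<otimes> a" "z = t \<otimes> a"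
        by auto
      then show ?thesis
        using assms by (auto simp: l_distr intro!: image_eqI[where x = "s \<oplus> t"])
    qed
    show "\<one>\<^bsub>add_monoid R\<^esub> \<in> (\<lambda>r. r \<otimes> a) ` carrier R"
      using assms by (auto intro!: image_eqI[where x = "\<zero>"])
    show "inv\<^bsub>add_monoid R\<^esub> y \<in> (\<lambda>r. r \<otimes> a) ` carrier R"
      if "y \<in> (\<lambda>r. r \<otimes> a) ` carrier R" for y
    proof -
      from that obtain s where "s \<in> carrier R" "y = s \<otimes> a"
        by auto
      then show ?thesis
        using assms
        by (auto simp: l_minus simp flip: a_inv_def intro!: image_eqI[where x = "\<ominus> s"])
    qed
  qed
  moreover have "y \<otimes> b \<in> (\<lambda>r. r \<otimes> a) ` carrier R"
    if "b \<in> (\<lambda>r. r \<otimes> a) ` carrier R" "y \<in> carrier R" for b y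
    using assms that by (auto simp flip: m_assoc)
  ultimately show ?thesis
    by (intro left_ideal.intro left_ideal_axioms.intro ring_axioms)
qed

lemma (in ring) proper_left_ideal_subset_maximal:
  assumes fin: "finite (carrier R)" and I: "left_ideal I R" "I \<noteq> carrier R"
  obtains M where "maximal_left_ideal M R" "I \<subseteq> M"
proof -
  let ?S = "{K. left_ideal K R \<and> K \<noteq> carrier R}"
  have sub: "K \<subseteq> carrier R" if "left_ideal K R" for K
    using that by (simp add: left_ideal_def additive_subgroup.a_subset)
  have "finite ?S"
    by (rule finite_subset[of _ "Pow (carrier R)"]) (use fin sub in auto)
  then obtain M where M: "M \<in> ?S" "I \<subseteq> M" and max: "\<And>K. K \<in> ?S \<Longrightarrow> M \<subseteq> K \<Longrightarrow> M = K"
    using finite_has_maximal2[of ?S I] I by auto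
  have "maximal_left_ideal M R"
    unfolding maximal_left_ideal_def maximal_left_ideal_axioms_def
    using M max by auto
  then show thesis
    using M that by blast
qed

lemma (in local_ring) jacobson_radical_maximal_left_ideal:
  "maximal_left_ideal (jacobson_radical R) R"
proof -
  obtain M where M: "maximal_left_ideal M R" and uniq: "\<And>N. maximal_left_ideal N R \<Longrightarrow> N = M"
    using unique_maximal_left_ideal by blast
  have "M \<subseteq> carrier R"
    using M by (simp add: maximal_left_ideal_def left_ideal_def additive_subgroup.a_subset)
  moreover have "{M. maximal_left_ideal M R} = {M}"
    using M uniq by blast
  ultimately have "jacobson_radical R = M"
    unfolding jacobson_radical_def by auto
  then show ?thesis
    using M by simp
qed

text \<open>
  Finiteness enters twice: it provides a maximal left ideal above each proper left ideal, and it turns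
  one-sided inverses into two-sided ones.
\<close>

lemma (in local_ring) finite_local_ring_Units:
  assumes fin: "finite (carrier R)"
  shows "Units R = carrier R - jacobson_radical R"
proof -
  let ?J = "jacobson_radical R"
  interpret J: maximal_left_ideal ?J R
    by (rule jacobson_radical_maximal_left_ideal)
  show ?thesis
  proof (intro equalityI subsetI)
    fix u assume u: "u \<in> Units R"
    have "u \<notin> ?J"
    proof
      assume "u \<in> ?J"
      then have "r \<in> ?J" if "r \<in> carrier R" for r
        using J.I_l_closed[of u "r \<otimes> inv u"] u that by (simp add: m_assoc)
      then show False
        using J.I_notcarr J.a_subset by auto
    qed
    then show "u \<in> carrier R - ?J"
      using u by auto
  next
    fix u assume u: "u \<in> carrier R - ?J"
    let ?I = "(\<lambda>r. r \<otimes> u) ` carrier R"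
    have "u \<in> ?I"
      using u by (auto intro!: image_eqI[where x = "\<one>"])
    have "?I = carrier R"
    proof (rule ccontr)
      assume "?I \<noteq> carrier R"
      moreover have "left_ideal ?I R"
        using u by (intro left_ideal_principal) auto
      ultimately obtain M where M: "maximal_left_ideal M R" "?I \<subseteq> M"
        using proper_left_ideal_subset_maximal[OF fin] by blast
      then have "M = ?J"
        using unique_maximal_left_ideal jacobson_radical_maximal_left_ideal by blast
      then show False
        using M \<open>u \<in> ?I\<close> u by auto
    qed
    then obtain r where "r \<in> carrier R" "r \<otimes> u = \<one>"
      by (metis imageE one_closed)
    then show "u \<in> Units R"
      using finite_right_inverse_Units(2)[OF fin] u by auto
  qed
qed

section \<open>Counting factorizations\<close>

lemma (in local_ring) card_factor_pairs_unit:
  assumes fin: "finite (carrier R)" and x: "x \<in> Units R"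
  shows "card {(a, b). a \<in> carrier R \<and> b \<in> carrier R \<and> a \<otimes> b = x} = card (Units R)"
proof -
  have "{(a, b). a \<in> carrier R \<and> b \<in> carrier R \<and> a \<otimes> b = x} = (\<lambda>u. (u, inv u \<otimes> x)) ` Units R"
    (is "?P = ?A")
  proof (intro equalityI subsetI)
    fix p assume "p \<in> ?P"
    then obtain a b where p: "p = (a, b)" "a \<in> carrier R" "b \<in> carrier R" "a \<otimes> b = x"
      by auto
    then have "a \<in> Units R"
      using finite_mult_in_Units(1)[OF fin] x by simp
    moreover have "inv a \<otimes> x = b"
      using p calculation by (auto simp flip: m_assoc)
    ultimately show "p \<in> ?A"
      using p by auto
  next
    fix p assume "p \<in> ?A"
    moreover have "u \<otimes> (inv u \<otimes> x) = x" if "u \<in> Units R" for u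
      using that x by (simp add: Units_closed flip: m_assoc)
    ultimately show "p \<in> ?P"
      using x by auto
  qed
  then show ?thesis
    by (simp add: card_image inj_on_def)
qed

text \<open>
  The summand \<open>2 u\<close>, with \<open>u\<close> the number of units, counts the pairs with exactly one unit factor; the
  other summand counts the pairs without a unit factor, whose product is always zero.
\<close>

lemma (in local_ring) card_factor_pairs_radical:
  assumes fin: "finite (carrier R)"
    and sq: "\<And>a b. a \<in> jacobson_radical R \<Longrightarrow> b \<in> jacobson_radical R \<Longrightarrow> a \<otimes> b = \<zero>"
    and x: "x \<in> jacobson_radical R"
  shows "card {(a, b). a \<in> carrier R \<and> b \<in> carrier R \<and> a \<otimes> b = x} =
    2 * card (Units R) + (if x = \<zero> then card (jacobson_radical R) ^ 2 else 0)"
proof -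
  let ?J = "jacobson_radical R"
  let ?A = "(\<lambda>u. (u, inv u \<otimes> x)) ` Units R"
  let ?B = "(\<lambda>v. (x \<otimes> inv v, v)) ` Units R"
  let ?C = "if x = \<zero> then ?J \<times> ?J else {}"
  have J_sub: "?J \<subseteq> carrier R"
    by (auto simp: jacobson_radical_def)
  note U = finite_local_ring_Units[OF fin]
  have xR: "x \<in> carrier R" and x_nonunit: "x \<notin> Units R"
    using x J_sub U by auto
  \<comment> \<open>If one of these products were a unit, so would be its factor \<open>x\<close>.\<close>
  have cancel_l: "inv u \<otimes> x \<in> ?J" and cancel_r: "x \<otimes> inv u \<in> ?J" if "u \<in> Units R" for u
    using finite_mult_in_Units[OF fin, of "inv u" x] finite_mult_in_Units[OF fin, of x "inv u"]
      that xR x_nonunit U by auto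
  have "{(a, b). a \<in> carrier R \<and> b \<in> carrier R \<and> a \<otimes> b = x} = ?A \<union> ?B \<union> ?C"
    (is "?P = _")
  proof (intro equalityI subsetI)
    fix p assume "p \<in> ?P"
    then obtain a b where p: "p = (a, b)" "a \<in> carrier R" "b \<in> carrier R" "a \<otimes> b = x"
      by auto
    consider "a \<in> Units R" | "b \<in> Units R" | "a \<in> ?J" "b \<in> ?J"
      using p U by auto
    then show "p \<in> ?A \<union> ?B \<union> ?C"
    proof cases
      case 1
      then have "inv a \<otimes> x = b"
        using p by (auto simp flip: m_assoc)
      with 1 p(1) show ?thesis by blast
    next
      case 2
      then have "x \<otimes> inv b = a"
        using p by (auto simp: m_assoc)
      with 2 p(1) show ?thesis by blast
    next
      case 3
      with p sq show ?thesis by auto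
    qed
  next
    fix p assume "p \<in> ?A \<union> ?B \<union> ?C"
    then consider "p \<in> ?A" | "p \<in> ?B" | "p \<in> ?C" by blast
    then show "p \<in> ?P"
    proof cases
      case 1
      with xR show ?thesis by (auto simp: Units_closed simp flip: m_assoc)
    next
      case 2
      with xR show ?thesis by (auto simp: Units_closed m_assoc)
    next
      case 3
      with J_sub sq show ?thesis by (auto split: if_splits)
    qed
  qed
  moreover have "?A \<inter> ?B = {}" "(?A \<union> ?B) \<inter> ?C = {}"
    using cancel_l cancel_r U by (auto split: if_splits)
  moreover have "finite (Units R)" "finite ?J"
    using fin U J_sub by (auto intro: finite_subset)
  moreover have "card ?A = card (Units R)" "card ?B = card (Units R)"
    by (simp_all add: card_image inj_on_def)
  ultimately show ?thesis
    by (simp add: card_Un_disjoint card_cartesian_product power2_eq_square)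
qed

section \<open>Multiplication probabilities\<close>

theorem theorem4p7:
  fixes R :: "('a, 'm) ring_scheme"
    and F :: "('b, 'k) ring_scheme"
    and q n :: nat
    and x :: 'a
  assumes "local_ring R"
    and "finite (carrier R)"
    and "n > 0"
    and "card (carrier R) = q ^ n"
    and "field F" and "finite (carrier F)" and "card (carrier F) = q"
    and "R Quot (jacobson_radical R) \<simeq> F"
    and "ideal_prod R (jacobson_radical R) (jacobson_radical R) = {\<zero>\<^bsub>R\<^esub>}"
    and "x \<in> carrier R"
  shows "(x \<noteq> \<zero>\<^bsub>R\<^esub> \<and> x \<in> jacobson_radical R \<longrightarrow>
            mult_prob R x = 2 * (real q - 1) / real q ^ (n + 1))
       \<and> (x \<notin> jacobson_radical R \<longrightarrow>
            mult_prob R x = (real q - 1) / real q ^ (n + 1))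
       \<and> (x = \<zero>\<^bsub>R\<^esub> \<longrightarrow>
            mult_prob R x = (real q ^ (n - 1) + 2 * real q - 2) / real q ^ (n + 1))"
proof -
  interpret local_ring R by fact
  let ?J = "jacobson_radical R"
  interpret J: maximal_left_ideal ?J R
    by (rule jacobson_radical_maximal_left_ideal)
  have J_sub: "?J \<subseteq> carrier R"
    by (rule J.a_subset)
  note U = finite_local_ring_Units[OF assms(2)]
  have "q \<ge> 2"
  proof -
    interpret F: field F by fact
    have "card {\<zero>\<^bsub>F\<^esub>, \<one>\<^bsub>F\<^esub>} \<le> card (carrier F)"
      using assms(6) by (intro card_mono) auto
    then show ?thesis
      using assms(7) by simp
  qed
  have q_pow: "q ^ n = q ^ (n - 1) * q"
    using assms(3) by (simp flip: power_minus_mult)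
  then have real_q_pow: "real q ^ n = real q ^ (n - 1) * real q"
    by (metis of_nat_mult of_nat_power)
  have "card (a_rcosets\<^bsub>R\<^esub> ?J) = q"
    using assms(7,8) bij_betw_same_card
    unfolding is_ring_iso_def ring_iso_def FactRing_def by fastforce
  moreover have "card ?J * card (a_rcosets\<^bsub>R\<^esub> ?J) = card (carrier R)"
    using a_lagrange[OF assms(2) J.additive_subgroup_axioms] by (simp add: order_def mult.commute)
  ultimately have "card ?J * q = q ^ (n - 1) * q"
    using assms(4) q_pow by simp
  then have card_J: "card ?J = q ^ (n - 1)"
    using \<open>q \<ge> 2\<close> by simp
  have "q ^ (n - 1) \<le> q ^ n"
    using \<open>q \<ge> 2\<close> by (intro power_increasing) auto
  moreover have "card (Units R) = q ^ n - q ^ (n - 1)"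
    unfolding U using card_Diff_subset[OF _ J_sub] J_sub assms(2,4) card_J
    by (simp add: finite_subset)
  ultimately have card_U: "real (card (Units R)) = real q ^ (n - 1) * (real q - 1)"
    by (simp add: of_nat_diff real_q_pow algebra_simps)
  have sq: "a \<otimes>\<^bsub>R\<^esub> b = \<zero>\<^bsub>R\<^esub>" if "a \<in> ?J" "b \<in> ?J" for a b
    using ideal_prod.prod[OF that, of R] assms(9) by simp
  \<comment> \<open>Split so that the factor \<open>q ^ (n - 1)\<close>, common to all the counts, cancels.\<close>
  have total: "real (card (carrier R)) ^ 2 = real q ^ (n - 1) * real q ^ (n + 1)"
    by (simp add: assms(4) real_q_pow power2_eq_square)
  have pos: "real q ^ (n - 1) > 0"
    using \<open>q \<ge> 2\<close> by simp
  have nonunit: "mult_prob R x = 2 * (real q - 1) / real q ^ (n + 1)"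
    if "x \<noteq> \<zero>\<^bsub>R\<^esub>" "x \<in> ?J"
    using card_factor_pairs_radical[OF assms(2) sq that(2)] that(1) pos
    unfolding mult_prob_def total by (simp add: card_U)
  have unit: "mult_prob R x = (real q - 1) / real q ^ (n + 1)" if "x \<notin> ?J"
  proof -
    have "x \<in> Units R"
      using that assms(10) U by simp
    then show ?thesis
      using card_factor_pairs_unit[OF assms(2)] pos
      unfolding mult_prob_def total by (simp add: card_U)
  qed
  have zero: "mult_prob R x = (real q ^ (n - 1) + 2 * real q - 2) / real q ^ (n + 1)"
    if "x = \<zero>\<^bsub>R\<^esub>"
  proof -
    have "x \<in> ?J"
      using that J.zero_closed by simp
    then have "real (card {(a, b). a \<in> carrier R \<and> b \<in> carrier R \<and> a \<otimes>\<^bsub>R\<^esub> b = x}) =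
        real q ^ (n - 1) * (real q ^ (n - 1) + 2 * real q - 2)"
      using card_factor_pairs_radical[OF assms(2) sq] that
      by (simp add: card_U card_J algebra_simps power2_eq_square)
    then show ?thesis
      using pos unfolding mult_prob_def total by simp
  qed
  show ?thesis
    using nonunit unit zero by blast
qed

end
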